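(* Let $k \geq 3$ be an integer, and let $\left(A_i^{(k)}\right)_{i=1}^{\infty}$ be the strictly increasing sequence of positive integers defined in the context. Then \[ \gamma_k = \liminf_{n \to \infty} \frac{g_k(n)}{n} \geq \sum_{i=1}^{\infty} \left( \frac{1}{A_{2i-1}^{(k)}} - \frac{1}{A_{2i}^{(k)}} \right). \] In particular, \[ \gamma_k \geq 1 - \frac{1}{2^k} - \frac{1}{3^{k-1}}. \]
   Context: For positive integers $k$ and $n$, $g_k(n)$ denotes the cardinality of the largest subset of $\{1,2,\ldots,n\}$ that contains no integer geometric progression of length $k$ with integer ratio, i.e. no progression $(a, ar, \ldots, ar^{k-1})$ with $a$ a positive integer and $r \geq 2$ an integer. The constant $\gamma_k$ is defined by $\gamma_k = \liminf_{n\to\infty} g_k(n)/n$. Here $(u,v] = \{x \in \mathbf{R} : u < x \leq v\}$. A set of positive real numbers is $k$-good if it contains no sequence $(a, ar, \ldots, ar^{k-1})$ with $a$ a positive real number and $r \geq 2$ an integer. For a $k$-good set $G \subseteq (0,1]$, a number $x \in (0,1] \setminus G$ is $k$-bad with respect to $G$ if there exists an integer $r \geq 2$ such that $xr^j \in G$ for all $j \in \{1, \ldots, k-1\}$, and $\operatorname{Bad}(G)$ is the set of all $x \in (0,1] \setminus G$ that are $k$-bad with respect to $G$. For each $k \geq 3$ there exists a unique strictly increasing sequence $\left(A_i^{(k)}\right)_{i=1}^{\infty}$ of positive integers with $A_1^{(k)} = 1$ such that $G^{(k)} = \bigcup_{i=1}^{\infty} \left( 1/A_{2i}^{(k)}, 1/A_{2i-1}^{(k)}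 \right]$ is $k$-good and $\operatorname{Bad}\left(G^{(k)}\right) = \bigcup_{i=1}^{\infty} \left( 1/A_{2i+1}^{(k)}, 1/A_{2i}^{(k)} \right]$; this is the sequence referred to in the claim. *)

theory Defs
  imports Complex_Main "HOL-Library.Extended_Real"
begin

definition gp_free :: "nat \<Rightarrow> nat set \<Rightarrow> bool" where
  "gp_free k S \<longleftrightarrow> \<not> (\<exists>a r. a > 0 \<and> r \<ge> 2 \<and> (\<forall>j<k. a * r ^ j \<in> S))"

definition gp_max :: "nat \<Rightarrow> nat \<Rightarrow> nat" where
  "gp_max k n = Max (card ` {S. S \<subseteq> {1..n} \<and> gp_free k S})"

(* Taken in the extended reals because liminf needs a complete lattice; the ratios lie in [0,1]. *)
definition gp_gamma :: "nat \<Rightarrow> ereal" where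
  "gp_gamma k = liminf (\<lambda>n. ereal (real (gp_max k n) / real n))"

definition gp_good :: "nat \<Rightarrow> real set \<Rightarrow> bool" where
  "gp_good k G \<longleftrightarrow>
     \<not> (\<exists>(a::real) (r::nat). a > 0 \<and> r \<ge> 2 \<and> (\<forall>j<k. a * real r ^ j \<in> G))"

definition gp_Bad :: "nat \<Rightarrow> real set \<Rightarrow> real set" where
  "gp_Bad k G = {x \<in> {0<..1} - G. \<exists>r::nat. r \<ge> 2 \<and> (\<forall>j\<in>{1..k-1}. x * real r ^ j \<in> G)}"

definition seq_set :: "(nat \<Rightarrow> nat) \<Rightarrow> real set" where
  "seq_set A = (\<Union>i\<in>{1..}. {1 / real (A (2*i)) <.. 1 / real (A (2*i-1))})"

(* Sequences are indexed from 1, as usual for the A_i. The value at 0 plays no role in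
   the mathematics; it is normalised to 0 so that the sequence is unique as a function
   on nat. Positivity of A i for i >= 1 follows from A 1 = 1 and monotonicity. *)
definition is_gp_seq :: "nat \<Rightarrow> (nat \<Rightarrow> nat) \<Rightarrow> bool" where
  "is_gp_seq k A \<longleftrightarrow>
     A 0 = 0 \<and> A 1 = 1 \<and> strict_mono_on {1..} A \<and>
     gp_good k (seq_set A) \<and>
     gp_Bad k (seq_set A) = (\<Union>i\<in>{1..}. {1 / real (A (2*i+1)) <.. 1 / real (A (2*i))})"

(* For k >= 3 there is exactly one such sequence. *)
definition gp_seq :: "nat \<Rightarrow> nat \<Rightarrow> nat" where
  "gp_seq k = (THE A. is_gp_seq k A)"

end

theory Submission
  imports Defs "HOL-Library.Disjoint_Sets"
begin

text \<open>
  A good set \<open>G\<close> of reals yields a progression-free set of integers for every \<open>n\<close>, namely the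
  integers in the dilate \<open>n G\<close>. If \<open>G\<close> contains finitely many disjoint subintervals of \<open>(0,1]\<close>,
  these integers number at least \<open>n\<close> times the total length of the intervals, up to a bounded
  error, so that total length bounds \<open>gp_gamma\<close> from below (\<open>gp_gamma_ge_sum_lengths\<close>). Both
  bounds are instances. The first takes the intervals \<open>(1/A(2i+2), 1/A(2i+1)]\<close> of the set
  \<open>seq_set A\<close> with \<open>A = gp_seq k\<close>, passing to the supremum over finite partial sums. The second
  takes \<open>(1/2^(k-1), 1]\<close> and \<open>(1/3^(k-1), 1/2^k]\<close>, whose union is good and has the length
  required.

  As \<open>gp_seq\<close> is a definite description, the first bound also needs that the sequence exists and
  is unique. The conditions on \<open>seq_set A\<close> say that it is good and that every other point
  of \<open>(0,1]\<close> is bad. Exactly one subset of \<open>(0,1]\<close> has these properties, the one obtained by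
  running through \<open>(0,1]\<close> from the top and taking every point that is not yet bad
  (\<open>good_Bad_iff_greedy_set\<close>). Membership of \<open>x\<close> in it is a function of the integer part
  of \<open>1/x\<close>, because \<open>\<lfloor>\<lfloor>y\<rfloor> / q\<rfloor> = \<lfloor>y / q\<rfloor>\<close> for every positive integer \<open>q\<close>. The set is therefore a
  union of intervals with reciprocal integer endpoints, and the sequence must list the integers
  at which membership switches (\<open>is_gp_seq_iff_switch_seq\<close>). It is infinite because membership
  switches infinitely often (\<open>ex_greater_greedy_eq\<close>).
\<close>

section \<open>Density bounds from good sets\<close>

lemma gp_max_ge_card:
  assumes "S \<subseteq> {1..n}" "gp_free k S"
  shows "card S \<le> gp_max k n"
proof -
  have "finite {S. S \<subseteq> {1..n} \<and> gp_free k S}"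
    by (rule finite_subset[of _ "Pow {1..n}"]) auto
  then show ?thesis
    unfolding gp_max_def using assms by (intro Max_ge) auto
qed

lemma gp_free_dilate:
  assumes "gp_good k G" "n > 0"
  shows "gp_free k {m\<in>{1..n}. real m / real n \<in> G}"
  unfolding gp_free_def
proof (intro notI, elim exE conjE)
  fix a r :: nat
  assume "a > 0" "r \<ge> 2" and *: "\<forall>j<k. a * r ^ j \<in> {m\<in>{1..n}. real m / real n \<in> G}"
  have "real a / real n > 0" using \<open>a > 0\<close> \<open>n > 0\<close> by simp
  moreover have "\<forall>j<k. (real a / real n) * real r ^ j \<in> G" using * by auto
  ultimately show False using assms(1) \<open>r \<ge> 2\<close> unfolding gp_good_def by blast
qed

lemma card_dilate_interval_ge:
  fixes u v :: real
  assumes "0 \<le> u" "u \<le> v" "n > 0"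
  shows "finite {m::nat. real m / real n \<in> {u<..v}}"
    and "real (card {m::nat. real m / real n \<in> {u<..v}}) \<ge> (v - u) * real n - 1"
proof -
  let ?a = "nat \<lfloor>u * real n\<rfloor>" and ?b = "nat \<lfloor>v * real n\<rfloor>"
  have "0 \<le> u * real n" "0 \<le> v * real n" using assms by auto
  then have "{m::nat. real m / real n \<in> {u<..v}} = {?a<..?b}"
    using assms(3) by (auto simp: field_simps le_nat_floor) (linarith+)
  moreover have "real ?b \<ge> v * real n - 1" "real ?a \<le> u * real n"
    using \<open>0 \<le> u * real n\<close> by linarith+
  ultimately show "finite {m::nat. real m / real n \<in> {u<..v}}"
    and "real (card {m::nat. real m / real n \<in> {u<..v}}) \<ge> (v - u) * real n - 1"
    by (auto simp: algebra_simps)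
qed

text \<open>
  The elements of \<open>{1..n}\<close> in the dilate \<open>n G\<close> contain no progression, since dividing one by \<open>n\<close>
  would put it into \<open>G\<close>. An interval of length \<open>l\<close> captures at least \<open>l n - 1\<close> of them, and the
  error of at most one per interval is negligible after division by \<open>n\<close> because the family is
  finite.
\<close>

lemma gp_gamma_ge_sum_lengths:
  fixes u v :: "'i \<Rightarrow> real"
  assumes good: "gp_good k G"
    and "finite I"
    and bounds: "\<And>i. i \<in> I \<Longrightarrow> 0 \<le> u i \<and> u i \<le> v i \<and> v i \<le> 1"
    and sub: "\<And>i. i \<in> I \<Longrightarrow> {u i<..v i} \<subseteq> G"
    and disj: "disjoint_family_on (\<lambda>i. {u i<..v i}) I"
  shows "ereal (\<Sum>i\<in>I. v i - u i) \<le> gp_gamma k"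
proof -
  let ?s = "\<Sum>i\<in>I. v i - u i"
  have bound: "?s - real (card I) / real n \<le> real (gp_max k n) / real n" if "n > 0" for n
  proof -
    define S where "S i = {m::nat. real m / real n \<in> {u i<..v i}}" for i
    have fin: "finite (S i)" and card: "real (card (S i)) \<ge> (v i - u i) * real n - 1"
      if "i \<in> I" for i
      using card_dilate_interval_ge[of "u i" "v i" n] bounds[OF that] \<open>n > 0\<close>
      by (auto simp: S_def)
    have "S i \<subseteq> {m\<in>{1..n}. real m / real n \<in> G}" if "i \<in> I" for i
    proof
      fix m assume m: "m \<in> S i"
      then have "real m / real n > 0" "real m / real n \<le> 1" "real m / real n \<in> G"
        using bounds[OF that] sub[OF that] by (auto simp: S_def)
      then show "m \<in> {m\<in>{1..n}. real m / real n \<in> G}"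
        using \<open>n > 0\<close> by (auto simp: field_simps)
    qed
    then have "card (\<Union>i\<in>I. S i) \<le> card {m\<in>{1..n}. real m / real n \<in> G}"
      by (intro card_mono) auto
    also have "\<dots> \<le> gp_max k n"
      by (rule gp_max_ge_card) (use gp_free_dilate[OF good \<open>n > 0\<close>] in auto)
    finally have "real (card (\<Union>i\<in>I. S i)) \<le> real (gp_max k n)" by simp
    moreover have "card (\<Union>i\<in>I. S i) = (\<Sum>i\<in>I. card (S i))"
    proof (rule card_UN_disjoint)
      show "\<forall>i\<in>I. \<forall>j\<in>I. i \<noteq> j \<longrightarrow> S i \<inter> S j = {}"
        using disj unfolding disjoint_family_on_def S_def by blast
    qed (use \<open>finite I\<close> fin in auto)
    moreover have "(\<Sum>i\<in>I. (v i - u i) * real n - 1) \<le> (\<Sum>i\<in>I. real (card (S i)))"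
      by (intro sum_mono card)
    ultimately have "?s * real n - real (card I) \<le> real (gp_max k n)"
      by (simp add: sum_subtractf flip: sum_distrib_right)
    then have "(?s * real n - real (card I)) / real n \<le> real (gp_max k n) / real n"
      by (rule divide_right_mono) simp
    then show ?thesis using \<open>n > 0\<close> by (simp add: diff_divide_distrib)
  qed
  have "(\<lambda>n. ?s - real (card I) / real n) \<longlonglongrightarrow> ?s - 0"
    by (intro tendsto_diff tendsto_const lim_const_over_n)
  then have "(\<lambda>n. ereal (?s - real (card I) / real n)) \<longlonglongrightarrow> ereal ?s" by simp
  then have "ereal ?s = liminf (\<lambda>n. ereal (?s - real (card I) / real n))"
    by (intro lim_imp_Liminf[symmetric] trivial_limit_sequentially)
  also have "\<dots> \<le> gp_gamma k"
    unfolding gp_gamma_def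
    by (intro Liminf_mono eventually_mono[OF eventually_gt_at_top[of 0]]) (simp add: bound)
  finally show ?thesis .
qed

section \<open>The greedy set\<close>

text \<open>
  Membership of \<open>x\<close> in the set built greedily from \<open>1\<close> downwards depends only on the integer
  part \<open>m\<close> of \<open>1/x\<close>: multiplying \<open>x\<close> by \<open>r ^ j\<close> replaces \<open>m\<close> by \<open>m div r ^ j\<close>. The predicate
  below is the greedy rule on these integer parts; \<open>m = 0\<close> stands for \<open>x > 1\<close>.
\<close>

function greedy :: "nat \<Rightarrow> nat \<Rightarrow> bool" where
  "greedy k m =
     (if m = 0 then False else \<not> (\<exists>r\<in>{2..}. \<forall>j\<in>{1..k-1}. greedy k (m div r ^ j)))"
  by pat_completeness auto
termination
proof (relation "measure snd"; clarsimp)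
  fix m r j :: nat
  assume "0 < m" "2 \<le> r" "Suc 0 \<le> j"
  then have "1 < r ^ j" by (intro one_less_power) auto
  with \<open>0 < m\<close> show "m div r ^ j < m" by simp
qed

declare greedy.simps [simp del]

lemma greedy_0 [simp]: "\<not> greedy k 0"
  by (simp add: greedy.simps)

lemma greedy_pos_iff:
  "m > 0 \<Longrightarrow> greedy k m \<longleftrightarrow> \<not> (\<exists>r\<ge>2. \<forall>j\<in>{1..k-1}. greedy k (m div r ^ j))"
  by (subst greedy.simps) auto

definition greedy_set :: "nat \<Rightarrow> real set" where
  "greedy_set k = {x. x > 0 \<and> greedy k (nat \<lfloor>1 / x\<rfloor>)}"

lemma floor_inverse_mult:
  fixes x :: real
  shows "nat \<lfloor>1 / (x * real q)\<rfloor> = nat \<lfloor>1 / x\<rfloor> div q"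
proof -
  have "\<lfloor>1 / (x * real q)\<rfloor> = \<lfloor>1 / x\<rfloor> div int q"
    using floor_divide_real_eq_div[of "int q" "1 / x"] by simp
  then show ?thesis by (simp add: nat_div_distrib')
qed

lemma floor_inverse_pos_iff:
  fixes x :: real
  assumes "x > 0"
  shows "nat \<lfloor>1 / x\<rfloor> > 0 \<longleftrightarrow> x \<le> 1"
  using assms by (simp add: le_floor_iff field_simps flip: zless_nat_eq_int_zless)

lemma greedy_set_subset: "greedy_set k \<subseteq> {0<..1}"
proof
  fix x assume "x \<in> greedy_set k"
  then have "x > 0" "nat \<lfloor>1 / x\<rfloor> > 0"
    unfolding greedy_set_def by (auto intro!: Nat.gr0I simp del: zero_less_nat_eq)
  then show "x \<in> {0<..1}" using floor_inverse_pos_iff by auto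
qed

lemma mem_greedy_set_iff:
  assumes "x \<in> {0<..1}"
  shows "x \<in> greedy_set k \<longleftrightarrow>
           \<not> (\<exists>r::nat. r \<ge> 2 \<and> (\<forall>j\<in>{1..k-1}. x * real r ^ j \<in> greedy_set k))"
proof -
  have "x * real r ^ j \<in> greedy_set k \<longleftrightarrow> greedy k (nat \<lfloor>1 / x\<rfloor> div r ^ j)"
    if "r \<ge> 2" for r j :: nat
    using assms that floor_inverse_mult[of x "r ^ j"] by (auto simp: greedy_set_def)
  then have "(\<exists>r::nat. r \<ge> 2 \<and> (\<forall>j\<in>{1..k-1}. x * real r ^ j \<in> greedy_set k)) \<longleftrightarrow>
             (\<exists>r\<ge>2. \<forall>j\<in>{1..k-1}. greedy k (nat \<lfloor>1 / x\<rfloor> div r ^ j))"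
    by blast
  then show ?thesis
    using assms greedy_pos_iff[of "nat \<lfloor>1 / x\<rfloor>" k] floor_inverse_pos_iff[of x]
    by (simp add: greedy_set_def)
qed

text \<open>
  If \<open>G\<close> is good and every other point of \<open>(0,1]\<close> is bad, then membership of \<open>x\<close>
  is decided by the multiples
  \<open>x * r ^ j\<close>, whose reciprocals have a smaller integer part. Induction on that integer part
  leaves only one candidate for \<open>G\<close>.
\<close>

lemma good_Bad_iff_greedy_set:
  assumes "k > 0" "G \<subseteq> {0<..1}"
  shows "gp_good k G \<and> gp_Bad k G = {0<..1} - G \<longleftrightarrow> G = greedy_set k"
proof
  assume G: "gp_good k G \<and> gp_Bad k G = {0<..1} - G"
  have rule: "x \<in> G \<longleftrightarrow> \<not> (\<exists>r::nat. r \<ge> 2 \<and> (\<forall>j\<in>{1..k-1}. x * real r ^ j \<in> G))"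
    if x: "x \<in> {0<..1}" for x
  proof
    assume "x \<in> G"
    show "\<not> (\<exists>r::nat. r \<ge> 2 \<and> (\<forall>j\<in>{1..k-1}. x * real r ^ j \<in> G))"
    proof (intro notI, elim exE conjE)
      fix r :: nat
      assume "r \<ge> 2" and *: "\<forall>j\<in>{1..k-1}. x * real r ^ j \<in> G"
      have "\<forall>j<k. x * real r ^ j \<in> G"
      proof (intro allI impI)
        fix j assume "j < k"
        then show "x * real r ^ j \<in> G"
          using * \<open>x \<in> G\<close> by (cases "j = 0") auto
      qed
      moreover have "x > 0" using x by simp
      ultimately show False using G \<open>r \<ge> 2\<close> unfolding gp_good_def by blast
    qed
  next
    assume "\<not> (\<exists>r::nat. r \<ge> 2 \<and> (\<forall>j\<in>{1..k-1}. x * real r ^ j \<in> G))"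
    then have "x \<notin> gp_Bad k G" unfolding gp_Bad_def by blast
    with G x show "x \<in> G" by blast
  qed
  have "x \<in> G \<longleftrightarrow> x \<in> greedy_set k" if "x > 0" for x
    using that
  proof (induction "nat \<lfloor>1 / x\<rfloor>" arbitrary: x rule: less_induct)
    case less
    show ?case
    proof (cases "x \<le> 1")
      case True
      then have x: "x \<in> {0<..1}" using less.prems by simp
      have "x * real r ^ j \<in> G \<longleftrightarrow> x * real r ^ j \<in> greedy_set k"
        if "r \<ge> 2" "j \<in> {1..k-1}" for r j :: nat
      proof (rule less.hyps)
        have "nat \<lfloor>1 / x\<rfloor> > 0" using floor_inverse_pos_iff[OF less.prems] True by simp
        moreover have "1 < r ^ j" using that by (intro one_less_power) auto
        ultimately have "nat \<lfloor>1 / x\<rfloor> div r ^ j < nat \<lfloor>1 / x\<rfloor>" by simp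
        then show "nat \<lfloor>1 / (x * real r ^ j)\<rfloor> < nat \<lfloor>1 / x\<rfloor>"
          using floor_inverse_mult[of x "r ^ j"] by simp
        show "0 < x * real r ^ j" using less.prems that by simp
      qed
      then show ?thesis
        unfolding rule[OF x] mem_greedy_set_iff[OF x] by blast
    next
      case False
      then show ?thesis using assms(2) greedy_set_subset[of k] by auto
    qed
  qed
  then show "G = greedy_set k" using assms(2) greedy_set_subset[of k] by fastforce
next
  assume eq: "G = greedy_set k"
  have "gp_good k G"
    unfolding gp_good_def
  proof (intro notI, elim exE conjE)
    fix a :: real and r :: nat
    assume "a > 0" "r \<ge> 2" and *: "\<forall>j<k. a * real r ^ j \<in> G"
    from *[rule_format, of 0] \<open>k > 0\<close> have "a \<in> G" by simp
    then have "a \<in> {0<..1}" using assms(2) by blast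
    moreover have "\<forall>j\<in>{1..k-1}. a * real r ^ j \<in> G" using * by auto
    ultimately have "a \<notin> G" using mem_greedy_set_iff[of a k] \<open>r \<ge> 2\<close> eq by blast
    with \<open>a \<in> G\<close> show False by contradiction
  qed
  moreover have "gp_Bad k G = {0<..1} - G"
    unfolding gp_Bad_def using mem_greedy_set_iff[of _ k] by (auto simp: eq)
  ultimately show "gp_good k G \<and> gp_Bad k G = {0<..1} - G" by blast
qed

section \<open>The sequence of switching points\<close>

text \<open>
  If all integers above \<open>n\<close> were members, then \<open>(n + 1) * 2 ^ k\<close> would be rejected by the
  ratio 2, since its quotients by \<open>2, \<dots>, 2 ^ (k - 1)\<close> all exceed \<open>n\<close>. Conversely, a rejected
  \<open>m\<close> has a member \<open>m div r\<close> with \<open>r ^ 2 \<le> m\<close>, because \<open>k \<ge> 3\<close> makes \<open>m div r ^ 2\<close> a member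
  too and hence nonzero. For \<open>m = (n + 1) ^ 2\<close> this member \<open>m div r\<close> exceeds \<open>n\<close>, so \<open>n\<close>
  cannot bound all members.
\<close>

lemma ex_greater_greedy_eq:
  assumes "k \<ge> 3"
  shows "\<exists>m>n. greedy k m = b"
proof (cases b)
  case False
  show ?thesis
  proof (rule ccontr)
    assume "\<not> ?thesis"
    then have *: "greedy k m" if "m > n" for m using that False by auto
    let ?m = "Suc n * 2 ^ k"
    have "greedy k (?m div 2 ^ j)" if "j \<in> {1..k-1}" for j
    proof (rule *)
      have "k = (k - j) + j" using that by auto
      then have "(2::nat) ^ k = 2 ^ (k - j) * 2 ^ j" by (metis power_add)
      then have "?m = Suc n * 2 ^ (k - j) * 2 ^ j" by (simp only: mult.assoc)
      then have "?m div 2 ^ j = Suc n * 2 ^ (k - j)"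
        by (metis nonzero_mult_div_cancel_right power_not_zero zero_neq_numeral)
      then show "?m div 2 ^ j > n"
        using mult_le_mono2[of 1 "2 ^ (k - j)" "Suc n"] by simp
    qed
    then have "\<not> greedy k ?m" by (subst greedy_pos_iff) auto
    moreover have "?m > n" using mult_le_mono2[of 1 "2 ^ k" "Suc n"] by simp
    ultimately show False using * by blast
  qed
next
  case True
  show ?thesis
  proof (rule ccontr)
    assume "\<not> ?thesis"
    then have *: "\<not> greedy k m" if "m > n" for m using that True by auto
    let ?m = "(Suc n)\<^sup>2"
    have "?m > n" by (simp add: power2_eq_square)
    then have "\<not> greedy k ?m" by (rule *)
    then obtain r where r: "r \<ge> 2" and g: "\<forall>j\<in>{1..k-1}. greedy k (?m div r ^ j)"
      by (subst (asm) greedy_pos_iff) auto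
    have g1: "greedy k (?m div r)" using bspec[OF g, of 1] assms by simp
    have "greedy k (?m div r\<^sup>2)" using bspec[OF g, of 2] assms by simp
    then have "?m div r\<^sup>2 \<noteq> 0" using greedy_0 by metis
    then have "r\<^sup>2 \<le> ?m" by (meson div_less not_less)
    then have "r \<le> Suc n" using power2_le_imp_le by blast
    then have "r * Suc n \<le> ?m" by (simp add: power2_eq_square del: mult_Suc mult_Suc_right)
    then have "Suc n \<le> ?m div r" using r by (simp add: less_eq_div_iff_mult_less_eq mult.commute)
    with * g1 show False by (meson Suc_le_lessD)
  qed
qed

text \<open>
  Starting at \<open>0\<close>, which is not a member, each value is the next point where membership changes,
  so the value at \<open>1\<close> is \<open>1\<close> and odd indices open the runs of members.
\<close>

primrec switch_seq :: "nat \<Rightarrow> nat \<Rightarrow> nat" where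
  "switch_seq k 0 = 0"
| "switch_seq k (Suc i) = (LEAST m. m > switch_seq k i \<and> (greedy k m \<longleftrightarrow> even i))"

lemma switch_seq_Suc:
  assumes "k \<ge> 3"
  shows "switch_seq k i < switch_seq k (Suc i)"
    and "greedy k (switch_seq k (Suc i)) \<longleftrightarrow> even i"
proof -
  have "\<exists>m. m > switch_seq k i \<and> (greedy k m \<longleftrightarrow> even i)"
    using ex_greater_greedy_eq[OF assms] by blast
  then have "switch_seq k (Suc i) > switch_seq k i
      \<and> (greedy k (switch_seq k (Suc i)) \<longleftrightarrow> even i)"
    unfolding switch_seq.simps by (rule LeastI_ex)
  then show "switch_seq k i < switch_seq k (Suc i)"
    and "greedy k (switch_seq k (Suc i)) \<longleftrightarrow> even i" by blast+
qed

lemma switch_seq_1: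
  assumes "k \<ge> 3" shows "switch_seq k 1 = 1"
proof -
  have "greedy k 1"
  proof (subst greedy_pos_iff)
    have "1 \<in> {1..k-1}" "\<not> greedy k (1 div r ^ 1)" if "r \<ge> 2" for r :: nat
      using assms that by auto
    then show "\<not> (\<exists>r\<ge>2. \<forall>j\<in>{1..k-1}. greedy k (1 div r ^ j))" by blast
  qed simp
  then show ?thesis by (auto intro!: Least_equality)
qed

lemma greedy_between_switches:
  assumes "k \<ge> 3" "switch_seq k i \<le> m" "m < switch_seq k (Suc i)"
  shows "greedy k m \<longleftrightarrow> odd i"
proof (cases "m = switch_seq k i")
  case True
  then show ?thesis using switch_seq_Suc(2)[OF assms(1)] by (cases i) auto
next
  case False
  then have "m > switch_seq k i" using assms(2) by simp
  moreover have "\<not> (m > switch_seq k i \<and> (greedy k m \<longleftrightarrow> even i))"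
    using assms(3) not_less_Least unfolding switch_seq.simps by blast
  ultimately show ?thesis by blast
qed

section \<open>Blocks of a sequence\<close>

lemma mem_block_iff:
  fixes x :: real
  assumes "x > 0" "0 < a" "0 < b"
  shows "x \<in> {1 / real b<..1 / real a} \<longleftrightarrow> a \<le> nat \<lfloor>1 / x\<rfloor> \<and> nat \<lfloor>1 / x\<rfloor> < b"
proof -
  have "a \<le> nat \<lfloor>1 / x\<rfloor> \<longleftrightarrow> real a \<le> 1 / x"
    using assms by (simp add: le_nat_iff le_floor_iff)
  moreover have "nat \<lfloor>1 / x\<rfloor> < b \<longleftrightarrow> 1 / x < real b"
    using assms by (simp add: nat_less_iff floor_less_iff)
  ultimately show ?thesis using assms by (auto simp: field_simps)
qed

lemma block_unique:
  fixes A :: "nat \<Rightarrow> nat"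
  assumes "strict_mono A" "A i \<le> m" "m < A (Suc i)" "A j \<le> m" "m < A (Suc j)"
  shows "i = j"
proof -
  have "A i < A (Suc j)" "A j < A (Suc i)" using assms by auto
  then have "i < Suc j" "j < Suc i" using strict_mono_less[OF assms(1)] by blast+
  then show ?thesis by simp
qed

lemma ex_block:
  fixes A :: "nat \<Rightarrow> nat"
  assumes "strict_mono A" "A 0 = 0"
  obtains i where "A i \<le> m" "m < A (Suc i)"
proof -
  have "m < A (Suc m)" using strict_mono_imp_increasing[OF assms(1), of "Suc m"] by simp
  then have ex: "\<exists>i. m < A i" by blast
  define i where "i = (LEAST i. m < A i)"
  have "m < A i" unfolding i_def using ex by (rule LeastI_ex)
  moreover have "i \<noteq> 0" using \<open>m < A i\<close> assms(2) by (intro notI) simp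
  ultimately obtain j where "i = Suc j" "m < A (Suc j)" by (cases i) auto
  moreover have "A j \<le> m" using not_less_Least[of j "\<lambda>i. m < A i"] \<open>i = Suc j\<close>
    unfolding i_def by simp
  ultimately show ?thesis using that by blast
qed

text \<open>
  The value \<open>0\<close> at index \<open>0\<close> makes the blocks \<open>[A i, A (i + 1))\<close> with \<open>i \<ge> 0\<close> partition the natural
  numbers. Block \<open>0\<close> contains only \<open>0\<close>, the integer part of \<open>1/x\<close> for \<open>x > 1\<close>; the others
  correspond to half-open intervals that partition \<open>(0,1]\<close>, and \<open>seq_set A\<close> consists of those
  with odd index.
\<close>

locale block_sequence =
  fixes A :: "nat \<Rightarrow> nat"
  assumes zero: "A 0 = 0" and one: "A 1 = 1" and mono: "strict_mono A"
begin

lemma pos: "i \<ge> 1 \<Longrightarrow> A i > 0"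
  using strict_mono_less[OF mono, of 0 i] zero by simp

definition block :: "nat \<Rightarrow> real set" where
  "block i = {1 / real (A (Suc i))<..1 / real (A i)}"

lemma block_pos: "x \<in> block i \<Longrightarrow> x > 0"
  unfolding block_def by (auto intro: le_less_trans[of _ "1 / real (A (Suc i))"])

lemma mem_block:
  assumes "i \<ge> 1"
  shows "x \<in> block i \<longleftrightarrow> x > 0 \<and> A i \<le> nat \<lfloor>1 / x\<rfloor> \<and> nat \<lfloor>1 / x\<rfloor> < A (Suc i)"
  using mem_block_iff[of x "A i" "A (Suc i)"] pos[of i] pos[of "Suc i"] assms block_pos[of x i]
  by (auto simp: block_def)

lemma block_subset: "i \<ge> 1 \<Longrightarrow> block i \<subseteq> {0<..1}"
proof
  fix x assume "i \<ge> 1" "x \<in> block i"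
  then have "x > 0" "nat \<lfloor>1 / x\<rfloor> > 0" using mem_block[of i x] pos[of i] by linarith+
  then show "x \<in> {0<..1}" using floor_inverse_pos_iff by auto
qed

lemma disjoint_blocks: "disjoint_family_on block {1..}"
  unfolding disjoint_family_on_def using block_unique[OF mono] by (fastforce simp: mem_block)

lemma blocks_cover:
  assumes "x \<in> {0<..1}"
  obtains i where "i \<ge> 1" "x \<in> block i"
proof -
  obtain i where i: "A i \<le> nat \<lfloor>1 / x\<rfloor>" "nat \<lfloor>1 / x\<rfloor> < A (Suc i)"
    using ex_block[OF mono zero] by blast
  have "nat \<lfloor>1 / x\<rfloor> > 0" using floor_inverse_pos_iff assms by simp
  then have "i \<ge> 1" using i one by (cases i) auto
  then show ?thesis using that mem_block[of i x] i assms by auto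
qed

lemma seq_set_eq: "seq_set A = (\<Union>i\<in>{i. odd i}. block i)"
proof -
  have "seq_set A = (\<Union>i\<in>(\<lambda>i. 2 * i - 1) ` {1..}. block i)"
    unfolding seq_set_def block_def by (auto simp: Suc_diff_Suc numeral_2_eq_2)
  also have "(\<lambda>i. 2 * i - 1) ` {1..} = {i::nat. odd i}"
  proof (intro equalityI subsetI)
    fix i :: nat assume "i \<in> {i. odd i}"
    then obtain j where "i = 2 * j + 1" by (auto elim: oddE)
    then show "i \<in> (\<lambda>i. 2 * i - 1) ` {1..}" by (intro image_eqI[of _ _ "Suc j"]) auto
  qed auto
  finally show ?thesis .
qed

lemma gap_set_eq:
  "(\<Union>i\<in>{1..}. {1 / real (A (2*i+1))<..1 / real (A (2*i))}) = {0<..1} - seq_set A"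
proof -
  have "(\<Union>i\<in>{1..}. {1 / real (A (2*i+1))<..1 / real (A (2*i))}) =
        (\<Union>i\<in>{i. even i \<and> i \<ge> 1}. block i)"
  proof -
    have "(*) 2 ` {1..} = {i::nat. even i \<and> i \<ge> 1}" by (auto elim!: evenE)
    then have "(\<Union>i\<in>{i. even i \<and> i \<ge> 1}. block i) = (\<Union>i\<in>(*) 2 ` {1..}. block i)" by simp
    then show ?thesis by (simp add: block_def)
  qed
  also have "\<dots> = {0<..1} - (\<Union>i\<in>{i. odd i}. block i)"
  proof (intro equalityI subsetI)
    fix x assume "x \<in> (\<Union>i\<in>{i. even i \<and> i \<ge> 1}. block i)"
    then obtain i where i: "even i" "i \<ge> 1" "x \<in> block i" by blast
    moreover have "x \<notin> block j" if "odd j" for j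
    proof -
      have "j \<ge> 1" using that by (cases j) auto
      moreover have "i \<noteq> j" using that i by blast
      ultimately show ?thesis
        using disjoint_family_onD[OF disjoint_blocks, of i j] i by auto
    qed
    ultimately show "x \<in> {0<..1} - (\<Union>i\<in>{i. odd i}. block i)" using block_subset by blast
  next
    fix x assume x: "x \<in> {0<..1} - (\<Union>i\<in>{i. odd i}. block i)"
    then obtain i where "i \<ge> 1" "x \<in> block i" using blocks_cover[of x] by blast
    with x show "x \<in> (\<Union>i\<in>{i. even i \<and> i \<ge> 1}. block i)" by auto
  qed
  finally show ?thesis unfolding seq_set_eq .
qed

lemma seq_set_subset: "seq_set A \<subseteq> {0<..1}"
proof -
  have "block i \<subseteq> {0<..1}" if "odd i" for i
    using block_subset[of i] odd_pos[OF that] by simp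
  then show ?thesis unfolding seq_set_eq by blast
qed

lemma is_gp_seq_iff:
  assumes "k > 0"
  shows "is_gp_seq k A \<longleftrightarrow> seq_set A = greedy_set k"
  using good_Bad_iff_greedy_set[OF assms seq_set_subset] zero one
    monotone_on_subset[OF mono subset_UNIV]
  unfolding is_gp_seq_def gap_set_eq by blast

end

lemma is_gp_seq_imp_block_sequence:
  assumes "is_gp_seq k A"
  shows "block_sequence A"
proof
  show "A 0 = 0" "A 1 = 1" using assms unfolding is_gp_seq_def by auto
  have "A i < A (Suc i)" for i
  proof (cases "i = 0")
    case False
    then show ?thesis
      using assms unfolding is_gp_seq_def by (auto intro: strict_mono_onD)
  qed (use \<open>A 0 = 0\<close> \<open>A 1 = 1\<close> in simp)
  then show "strict_mono A" by (simp add: strict_mono_Suc_iff)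
qed

text \<open>
  The intervals of \<open>A\<close> alternate between \<open>seq_set A\<close> and its complement. So \<open>seq_set A\<close> is
  the greedy set exactly if \<open>greedy k\<close> is true on the odd blocks of integers and false on the
  even ones. This makes \<open>A (i + 1)\<close> the first point after \<open>A i\<close> where \<open>greedy k\<close> changes,
  which is the recursion of \<open>switch_seq k\<close>.
\<close>

lemma is_gp_seq_iff_switch_seq:
  assumes "k \<ge> 3"
  shows "is_gp_seq k A \<longleftrightarrow> A = switch_seq k"
proof
  assume A: "is_gp_seq k A"
  interpret block_sequence A using A by (rule is_gp_seq_imp_block_sequence)
  have set: "seq_set A = greedy_set k" using is_gp_seq_iff[of k] A assms by simp
  have run: "greedy k m \<longleftrightarrow> odd i" if "A i \<le> m" "m < A (Suc i)" for i m
  proof (cases "i = 0")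
    case True
    then show ?thesis using that one by simp
  next
    case False
    then have "m > 0" using that pos[of i] by simp
    have m: "1 / real m \<in> block i" using mem_block[of i "1 / real m"] that False \<open>m > 0\<close> by simp
    have "greedy k m \<longleftrightarrow> 1 / real m \<in> seq_set A"
      unfolding set greedy_set_def using \<open>m > 0\<close> by simp
    also have "\<dots> \<longleftrightarrow> odd i"
    proof
      assume "1 / real m \<in> seq_set A"
      then obtain j where j: "odd j" "1 / real m \<in> block j" unfolding seq_set_eq by blast
      then have "j \<ge> 1" by (cases j) auto
      then have "i = j" using j m False disjoint_blocks unfolding disjoint_family_on_def by fastforce
      then show "odd i" using j by simp
    qed (use m seq_set_eq in blast)
    finally show ?thesis .
  qed
  have "A i = switch_seq k i" for i
  proof (induction i)
    case (Suc i)
    have "(LEAST m. m > A i \<and> (greedy k m \<longleftrightarrow> even i)) = A (Suc i)"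
    proof (rule Least_equality)
      have "greedy k (A (Suc i)) \<longleftrightarrow> odd (Suc i)"
        by (rule run) (use strict_monoD[OF mono] in auto)
      then show "A (Suc i) > A i \<and> (greedy k (A (Suc i)) \<longleftrightarrow> even i)"
        using strict_monoD[OF mono, of i "Suc i"] by simp
    next
      fix m assume m: "m > A i \<and> (greedy k m \<longleftrightarrow> even i)"
      then show "A (Suc i) \<le> m" using run[of i m] by (meson less_imp_le not_le)
    qed
    then show ?case using Suc by simp
  qed (simp add: zero)
  then show "A = switch_seq k" by blast
next
  assume eq: "A = switch_seq k"
  interpret block_sequence A
    by standard (use eq switch_seq_Suc[OF assms] switch_seq_1[OF assms] in
        \<open>auto simp: strict_mono_Suc_iff simp del: switch_seq.simps(2)\<close>)
  have "x \<in> seq_set A \<longleftrightarrow> x \<in> greedy_set k" if x: "x \<in> {0<..1}" for x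
  proof -
    obtain i where i: "i \<ge> 1" "x \<in> block i" using blocks_cover[OF x] .
    have "x \<in> greedy_set k \<longleftrightarrow> odd i"
      using greedy_between_switches[OF assms, of i "nat \<lfloor>1 / x\<rfloor>"] i mem_block[of i x] eq
      by (auto simp: greedy_set_def simp del: switch_seq.simps(2))
    moreover have "x \<in> seq_set A \<longleftrightarrow> odd i"
    proof
      assume "x \<in> seq_set A"
      then obtain j where j: "odd j" "x \<in> block j" unfolding seq_set_eq by blast
      then have "j \<ge> 1" by (cases j) auto
      then have "i = j" using j i disjoint_blocks unfolding disjoint_family_on_def by fastforce
      then show "odd i" using j by simp
    qed (use i seq_set_eq in blast)
    ultimately show ?thesis by blast
  qed
  then have "seq_set A = greedy_set k" using seq_set_subset greedy_set_subset[of k] by blast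
  then show "is_gp_seq k A" using is_gp_seq_iff[of k] assms by simp
qed

lemma is_gp_seq_gp_seq:
  assumes "k \<ge> 3"
  shows "is_gp_seq k (gp_seq k)"
  unfolding gp_seq_def
  by (rule theI[of _ "switch_seq k"]) (simp_all add: is_gp_seq_iff_switch_seq[OF assms])

section \<open>The two lower bounds\<close>

lemma gp_gamma_ge_gp_seq_sum:
  assumes "k \<ge> 3"
  shows "(\<Sum>i. ereal (1 / real (gp_seq k (2*i+1)) - 1 / real (gp_seq k (2*i+2)))) \<le> gp_gamma k"
proof -
  define A where "A = gp_seq k"
  have A: "is_gp_seq k A" unfolding A_def by (rule is_gp_seq_gp_seq[OF assms])
  interpret block_sequence A using A by (rule is_gp_seq_imp_block_sequence)
  have len: "0 \<le> 1 / real (A (Suc i)) \<and> 1 / real (A (Suc i)) \<le> 1 / real (A i)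
      \<and> 1 / real (A i) \<le> 1" if "i \<ge> 1" for i
    using pos[OF that] strict_monoD[OF mono, of i "Suc i"] by (simp add: frac_le)
  have "(\<Sum>i. ereal (1 / real (A (2*i+1)) - 1 / real (A (Suc (2*i+1))))) \<le> gp_gamma k"
  proof (rule suminf_bound, intro allI)
    fix n
    have "ereal (\<Sum>i<n. 1 / real (A (2*i+1)) - 1 / real (A (Suc (2*i+1)))) \<le> gp_gamma k"
    proof (rule gp_gamma_ge_sum_lengths)
      show "gp_good k (seq_set A)" using A unfolding is_gp_seq_def by blast
      show "{1 / real (A (Suc (2*i+1)))<..1 / real (A (2*i+1))} \<subseteq> seq_set A" for i
        unfolding seq_set_eq block_def[symmetric] by (rule UN_upper) simp
      have "disjoint_family_on (\<lambda>i. block (2*i+1)) {..<n}"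
        using disjoint_blocks unfolding disjoint_family_on_def by auto
      then show "disjoint_family_on
          (\<lambda>i. {1 / real (A (Suc (2*i+1)))<..1 / real (A (2*i+1))}) {..<n}"
        unfolding block_def .
    qed (use len in auto)
    then show "(\<Sum>i<n. ereal (1 / real (A (2*i+1)) - 1 / real (A (Suc (2*i+1))))) \<le> gp_gamma k"
      by simp
  qed (use len in auto)
  then show ?thesis unfolding A_def by simp
qed

text \<open>
  For \<open>k \<ge> 3\<close> this is the part of the greedy set above \<open>1 / 3 ^ (k - 1)\<close>. A progression inside
  has last term at most \<open>1\<close> and first term above \<open>1 / 3 ^ (k - 1)\<close>, which forces the ratio 2.
  Its first term then lies below the gap \<open>(1 / 2 ^ k, 1 / 2 ^ (k - 1)]\<close> and its last term above
  it, but doubling cannot jump over a gap whose endpoints differ by a factor 2.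
\<close>

lemma gp_good_two_intervals:
  assumes "k > 0"
  shows "gp_good k ({1 / 2 ^ (k-1)<..1} \<union> {1 / 3 ^ (k-1)<..1 / 2 ^ k})"
  unfolding gp_good_def
proof (intro notI, elim exE conjE)
  fix a :: real and r :: nat
  let ?U = "{1 / 2 ^ (k-1)<..1} \<union> {1 / 3 ^ (k-1)<..1 / 2 ^ k} :: real set"
  assume "a > 0" "r \<ge> 2" and U: "\<forall>j<k. a * real r ^ j \<in> ?U"
  have two: "(2::real) ^ k = 2 * 2 ^ (k-1)" using assms by (metis power_eq_if gr_implies_not0)
  have "(2::real) ^ (k-1) \<le> 3 ^ (k-1)" by (intro power_mono) auto
  then have "1 / 3 ^ (k-1) \<le> (1 / 2 ^ (k-1) :: real)" by (intro divide_left_mono) auto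
  moreover have "a \<in> ?U" using U[rule_format, of 0] assms by simp
  ultimately have a3: "a > 1 / 3 ^ (k-1)" by auto
  have "(1 / 2 ^ k :: real) \<le> 1" by simp
  moreover have "a * real r ^ (k-1) \<in> ?U" using U[rule_format, of "k-1"] assms by simp
  ultimately have last: "a * real r ^ (k-1) \<le> 1"
    unfolding Un_iff greaterThanAtMost_iff by linarith
  have "real r ^ (k-1) < 3 ^ (k-1)"
  proof (rule ccontr)
    assume "\<not> ?thesis"
    then have "a * 3 ^ (k-1) \<le> a * real r ^ (k-1)" using \<open>a > 0\<close> by (intro mult_left_mono) auto
    with a3 last show False by (simp add: field_simps)
  qed
  then have "real r < 3" by (rule power_less_imp_less_base) simp
  then have r: "r = 2" using \<open>r \<ge> 2\<close> by simp
  have "a \<le> 1 / 2 ^ (k-1)" using last r by (simp add: field_simps)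
  with \<open>a \<in> ?U\<close> have low: "a \<le> 1 / 2 ^ k" by auto
  \<comment> \<open>The last term exceeds \<open>(2/3) ^ (k-1)\<close>, which is at least \<open>1 / 2 ^ (k-1)\<close> because \<open>3 \<le> 4\<close>.\<close>
  have "(3::real) ^ (k-1) \<le> 4 ^ (k-1)" by (intro power_mono) auto
  also have "(4::real) ^ (k-1) = 2 ^ (k-1) * 2 ^ (k-1)" by (simp flip: power_mult_distrib)
  also have "\<dots> \<le> 2 ^ k * 2 ^ (k-1)" unfolding two by simp
  finally have three: "(3::real) ^ (k-1) \<le> 2 ^ k * 2 ^ (k-1)" .
  have "1 / 2 ^ k \<le> 1 / 3 ^ (k-1) * (2::real) ^ (k-1)" using three by (simp add: field_simps)
  also have "\<dots> < a * 2 ^ (k-1)" using a3 by (intro mult_strict_right_mono) auto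
  finally have high: "1 / 2 ^ k < a * 2 ^ (k-1)" .
  \<comment> \<open>The first term above \<open>1 / 2 ^ k\<close> is at most twice that number, so it falls into the gap.\<close>
  define j where "j = (LEAST j. 1 / 2 ^ k < a * 2 ^ j)"
  have j: "1 / 2 ^ k < a * 2 ^ j" unfolding j_def using high by (rule LeastI)
  have "j \<le> k - 1" unfolding j_def using high by (rule Least_le)
  have "j \<noteq> 0" using j low by (intro notI) simp
  then obtain i where i: "j = Suc i" by (cases j) auto
  then have "\<not> 1 / 2 ^ k < a * 2 ^ i"
    using not_less_Least[of i "\<lambda>j. 1 / 2 ^ k < a * 2 ^ j"] unfolding j_def by simp
  then have "a * 2 ^ j \<le> 1 / 2 ^ (k-1)" using i two by (simp add: field_simps)
  moreover have "a * 2 ^ j \<in> ?U" using U[rule_format, of j] r \<open>j \<le> k - 1\<close> assms by simp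
  ultimately show False using j by auto
qed

lemma gp_gamma_ge_explicit:
  assumes "k \<ge> 3"
  shows "ereal (1 - 1 / 2 ^ k - 1 / 3 ^ (k - 1)) \<le> gp_gamma k"
proof -
  let ?u = "\<lambda>b. if b then 1 / 2 ^ (k-1) else (1 / 3 ^ (k-1) :: real)"
  let ?v = "\<lambda>b. if b then 1 else (1 / 2 ^ k :: real)"
  have two: "(2::real) ^ k = 2 * 2 ^ (k-1)" using assms by (subst power_eq_if) auto
  \<comment> \<open>The lower interval has its endpoints in the right order; this fails for \<open>k = 2\<close>.\<close>
  have "(2::real) ^ k \<le> 3 ^ (k-1)"
    using assms
  proof (induction k rule: dec_induct)
    case (step n)
    then have "(2::real) ^ n * 2 \<le> 3 ^ (n-1) * 3" by (intro mult_mono) auto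
    then show ?case using step by (simp add: power_eq_if[of _ n] mult.commute)
  qed simp
  then have three: "1 / 3 ^ (k-1) \<le> (1 / 2 ^ k :: real)" by (intro divide_left_mono) auto
  have "ereal (\<Sum>b\<in>UNIV. ?v b - ?u b) \<le> gp_gamma k"
  proof (rule gp_gamma_ge_sum_lengths[OF gp_good_two_intervals])
    show "disjoint_family_on (\<lambda>b. {?u b<..?v b}) UNIV"
      unfolding disjoint_family_on_def two by (auto simp: field_simps)
  qed (use assms three in auto)
  also have "(\<Sum>b\<in>UNIV. ?v b - ?u b) = 1 - 1 / 2 ^ k - 1 / 3 ^ (k-1)"
    by (simp add: UNIV_bool two)
  finally show ?thesis .
qed

theorem theorem8:
  fixes k :: nat
  assumes "k \<ge> 3"
  shows "gp_gamma k \<ge>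
           (\<Sum>i. ereal (1 / real (gp_seq k (2*i+1)) - 1 / real (gp_seq k (2*i+2))))
         \<and> gp_gamma k \<ge> ereal (1 - 1 / 2 ^ k - 1 / 3 ^ (k - 1))"
  using gp_gamma_ge_gp_seq_sum[OF assms] gp_gamma_ge_explicit[OF assms] by blast

end
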